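(* Let $n\ge 1$ and $m$ be integers with $\binom{n}{2}-\lfloor n/2\rfloor\le m\le\binom{n}{2}$. Among all simple graphs with $n$ vertices and $m$ edges, the graph whose complement is a matching (with $\binom{n}{2}-m$ edges) has the maximum number of acyclic orientations.
   Context: An acyclic orientation of a simple graph is an assignment of directions to all its edges with no directed cycle. The complement of a graph $G$ on vertex set $V$ has edge set consisting of all pairs of distinct vertices of $V$ not adjacent in $G$. A matching is a set of pairwise vertex-disjoint edges. *)

theory Defs
  imports Complex_Main
begin

definition all_edges :: "'a set \<Rightarrow> 'a set set" where
  "all_edges V = {{u, v} | u v. u \<in> V \<and> v \<in> V \<and> u \<noteq> v}"

definition simple_graph :: "'a set \<Rightarrow> 'a set set \<Rightarrow> bool" where
  "simple_graph V E \<longleftrightarrow> finite V \<and> E \<subseteq> all_edges V"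

definition complement_edges :: "'a set \<Rightarrow> 'a set set \<Rightarrow> 'a set set" where
  "complement_edges V E = all_edges V - E"

definition matching :: "'a set set \<Rightarrow> bool" where
  "matching M \<longleftrightarrow> pairwise disjnt M"

text \<open>An orientation of a graph is encoded as its set of arcs. Edges have two distinct
  endpoints, so the second condition is never applied with \<open>u = v\<close>.\<close>

definition orientation :: "'a set set \<Rightarrow> ('a \<times> 'a) set \<Rightarrow> bool" where
  "orientation E D \<longleftrightarrow>
     (\<forall>u v. (u, v) \<in> D \<longrightarrow> {u, v} \<in> E) \<and>
     (\<forall>u v. {u, v} \<in> E \<longrightarrow> ((u, v) \<in> D) \<noteq> ((v, u) \<in> D))"

definition acyclic_orientations :: "'a set set \<Rightarrow> ('a \<times> 'a) set set" where
  "acyclic_orientations E = {D. orientation E D \<and> acyclic D}"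

end

theory Submission
  imports Defs
begin

text \<open>Acyclic orientations of \<open>G\<close> are exactly those induced by vertex potentials that are proper
  colourings, and \<open>G + uv\<close> has as many acyclic orientations as \<open>G\<close> plus the number of those
  of \<open>G\<close> induced by a potential with \<open>f u = f v\<close>. Let \<open>b c\<close> be an edge of the
  complement \<open>H\<close> and \<open>x\<close> an isolated vertex of \<open>H\<close>. Replacing \<open>b c\<close> by \<open>x c\<close> in \<open>H\<close> does not
  decrease the number of acyclic orientations: by the recursion it suffices to compare, in the
  graph without both edges, potentials with \<open>f x = f c\<close> and potentials with \<open>f b = f c\<close>. In the first
  case \<open>x\<close> is joined to everything but \<open>c\<close>, so the arcs at \<open>c\<close> are redundant and \<open>c\<close> may be
  moved to the level of \<open>b\<close> without losing information. If \<open>H\<close> has at most \<open>n / 2\<close> edges and is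
  not a matching, some \<open>b\<close> has degree at least two and an isolated \<open>x\<close> exists; the exchange
  then covers one more vertex, so iterating it ends in a matching. Matchings of equal
  size are isomorphic.\<close>

section \<open>Orientations induced by potentials\<close>

definition orient_by :: "('a \<Rightarrow> nat) \<Rightarrow> 'a set set \<Rightarrow> ('a \<times> 'a) set" where
  "orient_by f E = {(u, v). {u, v} \<in> E \<and> f u < f v}"

definition proper :: "('a \<Rightarrow> nat) \<Rightarrow> 'a set set \<Rightarrow> bool" where
  "proper f E \<longleftrightarrow> (\<forall>u v. {u, v} \<in> E \<longrightarrow> f u \<noteq> f v)"

text \<open>In a finite simple graph with distinct non-adjacent \<open>u\<close> and
  \<open>v\<close> these correspond to the acyclic orientations of the graph with \<open>u\<close>
  and \<open>v\<close> identified. Geometrically they are the regions of the graphical arrangement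
  that the hyperplane of the tie cuts.\<close>

definition tied_orientations :: "'a set set \<Rightarrow> 'a \<Rightarrow> 'a \<Rightarrow> ('a \<times> 'a) set set" where
  "tied_orientations E u v = {orient_by f E | f. proper f E \<and> f u = f v}"

lemma all_edges_iff: "{u, v} \<in> all_edges V \<longleftrightarrow> u \<in> V \<and> v \<in> V \<and> u \<noteq> v"
  by (auto simp: all_edges_def doubleton_eq_iff)

lemma edge_in_graph:
  assumes "simple_graph V E" "{u, v} \<in> E"
  shows "u \<in> V" "v \<in> V" "u \<noteq> v"
  using assms all_edges_iff[of u v V] by (auto simp: simple_graph_def)

lemma orientation_subset:
  assumes "simple_graph V E" "orientation E D"
  shows "D \<subseteq> V \<times> V"
proof (rule subrelI)
  fix u v assume "(u, v) \<in> D"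
  then have "{u, v} \<in> E"
    using assms(2) by (simp add: orientation_def)
  then show "(u, v) \<in> V \<times> V"
    using edge_in_graph[OF assms(1)] by blast
qed

lemma finite_acyclic_orientations:
  assumes "simple_graph V E"
  shows "finite (acyclic_orientations E)"
proof (rule finite_subset)
  show "acyclic_orientations E \<subseteq> Pow (V \<times> V)"
    using orientation_subset[OF assms] by (auto simp: acyclic_orientations_def)
  show "finite (Pow (V \<times> V))"
    using assms by (simp add: simple_graph_def)
qed

lemma orientation_orient_by:
  assumes "proper f E"
  shows "orientation E (orient_by f E)"
  using assms unfolding orientation_def orient_by_def proper_def
  by (auto simp: insert_commute) (metis insert_commute linorder_neqE_nat)

lemma acyclic_orient_by: "acyclic (orient_by f E)"
proof -
  have "f u < f v" if "(u, v) \<in> (orient_by f E)\<^sup>+" for u v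
    using that by induction (auto simp: orient_by_def)
  then show ?thesis
    by (auto simp: acyclic_def)
qed

text \<open>If an edge ascended under \<open>f\<close> but its arc were not in \<open>D\<close>, the
  reverse arc would be, and \<open>f\<close> would have to increase along that one too. Equal values
  at the ends of an edge are excluded in the same way.\<close>

lemma orientation_eq_orient_by:
  assumes D: "orientation E D" and inc: "\<And>u v. (u, v) \<in> D \<Longrightarrow> f u < f v"
  shows "proper f E" "D = orient_by f E"
proof -
  show "proper f E"
    unfolding proper_def using D inc unfolding orientation_def by (metis nat_neq_iff)
  have "(u, v) \<in> D \<longleftrightarrow> {u, v} \<in> E \<and> f u < f v" for u v
    using D inc unfolding orientation_def by (metis not_less_iff_gr_or_eq)
  then show "D = orient_by f E"
    by (auto simp: orient_by_def)
qed

lemma finite_acyclic_potential: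
  assumes "finite D" "acyclic D"
  obtains f :: "'a \<Rightarrow> nat" where "\<And>u v. (u, v) \<in> D \<Longrightarrow> f u < f v"
proof -
  \<comment> \<open>Counting strict predecessors works because, along an arc \<open>(u, v)\<close>,
    the predecessors of \<open>u\<close> persist and \<open>u\<close> itself is new: by acyclicity
    it does not precede itself.\<close>
  define f where "f x = card {y. (y, x) \<in> D\<^sup>+}" for x
  have "f u < f v" if uv: "(u, v) \<in> D" for u v
    unfolding f_def
  proof (rule psubset_card_mono)
    have "{y. (y, v) \<in> D\<^sup>+} \<subseteq> fst ` (D\<^sup>+)"
      by force
    then show "finite {y. (y, v) \<in> D\<^sup>+}"
      using assms(1) by (meson finite_imageI finite_subset finite_trancl)
    have "u \<notin> {y. (y, u) \<in> D\<^sup>+}"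
      using assms(2) by (auto simp: acyclic_def)
    moreover have "{y. (y, u) \<in> D\<^sup>+} \<subseteq> {y. (y, v) \<in> D\<^sup>+}" "u \<in> {y. (y, v) \<in> D\<^sup>+}"
      using uv by (auto intro: trancl.intros)
    ultimately show "{y. (y, u) \<in> D\<^sup>+} \<subset> {y. (y, v) \<in> D\<^sup>+}"
      by blast
  qed
  then show thesis
    by (rule that)
qed

text \<open>Acyclicity becomes the existence of a numerical witness, so that later arguments modify
  potentials and never inspect cycles.\<close>

lemma acyclic_orientations_eq:
  assumes "simple_graph V E"
  shows "acyclic_orientations E = {orient_by f E | f. proper f E}"
proof (intro equalityI subsetI)
  fix D assume D: "D \<in> acyclic_orientations E"
  then have "D \<subseteq> V \<times> V" "finite V"
    using orientation_subset[OF assms] assms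
    by (simp_all add: acyclic_orientations_def simple_graph_def)
  then have "finite D"
    by (meson finite_SigmaI finite_subset)
  then obtain f :: "'a \<Rightarrow> nat" where "\<And>u v. (u, v) \<in> D \<Longrightarrow> f u < f v"
    using D finite_acyclic_potential[of D] by (auto simp: acyclic_orientations_def)
  with D show "D \<in> {orient_by f E | f. proper f E}"
    using orientation_eq_orient_by[of E D f] by (auto simp: acyclic_orientations_def)
next
  fix D assume "D \<in> {orient_by f E | f. proper f E}"
  then show "D \<in> acyclic_orientations E"
    by (auto simp: acyclic_orientations_def orientation_orient_by acyclic_orient_by)
qed

section \<open>Adding an edge\<close>

text \<open>Every edge ascends under \<open>f\<close> in exactly one direction, so preserving the
  ascents also preserves the descents.\<close>

lemma orient_by_cong:
  assumes "proper f E" "\<And>p q. {p, q} \<in> E \<Longrightarrow> f p < f q \<Longrightarrow> g p < g q"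
  shows "proper g E" "orient_by g E = orient_by f E"
  using orientation_eq_orient_by[OF orientation_orient_by[OF assms(1)], of g] assms(2)
  by (auto simp: orient_by_def)

lemma break_tie:
  fixes f :: "'a \<Rightarrow> nat"
  assumes f: "proper f E" and "u \<noteq> v" "f u \<le> f v"
  shows "\<exists>g. proper g (insert {u, v} E) \<and> g u < g v \<and> orient_by g E = orient_by f E"
proof -
  \<comment> \<open>Doubling leaves gaps of at least two between distinct levels, so raising
    \<open>v\<close> by one reverses no strict comparison but does break a tie.\<close>
  define g where "g y = 2 * f y + (if y = v then 1 else 0)" for y
  have "proper g E" "orient_by g E = orient_by f E"
    by (rule orient_by_cong[OF f]; force simp: g_def)+
  moreover have "g u < g v"
    using assms by (simp add: g_def)
  ultimately show ?thesis
    by (intro exI[of _ g]) (auto simp: proper_def doubleton_eq_iff)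
qed

lemma proper_insert_subset: "proper f (insert e E) \<Longrightarrow> proper f E"
  by (auto simp: proper_def)

text \<open>The orientations of the larger graph split by the direction of the new edge. Forgetting
  that edge is injective on each class; the two images together give all acyclic orientations of
  \<open>E\<close>, and they overlap exactly in the tied ones. Inclusion-exclusion then gives the
  count.\<close>

lemma card_acyclic_orientations_insert:
  assumes G: "simple_graph V (insert {u, v} E)" and new: "{u, v} \<notin> E"
  shows "card (acyclic_orientations (insert {u, v} E)) =
    card (acyclic_orientations E) + card (tied_orientations E u v)"
proof -
  let ?E = "insert {u, v} E"
  have GE: "simple_graph V E" and uv: "u \<noteq> v"
    using G edge_in_graph[OF G, of u v] by (auto simp: simple_graph_def)
  define P where "P a b = {orient_by f ?E | f. proper f ?E \<and> f a < f b}" for a b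
  define r where "r D = {(p, q). (p, q) \<in> D \<and> {p, q} \<in> E}" for D :: "('a \<times> 'a) set"
  have r: "r (orient_by f ?E) = orient_by f E" for f
    by (auto simp: r_def orient_by_def)
  have split: "acyclic_orientations ?E = P u v \<union> P v u"
    unfolding acyclic_orientations_eq[OF G] P_def
    by (auto simp: proper_def) (metis linorder_neqE_nat)
  have disj: "P u v \<inter> P v u = {}"
  proof -
    have "(u, v) \<in> D" if "D \<in> P u v" for D
      using that by (auto simp: P_def orient_by_def)
    moreover have "(u, v) \<notin> D" if "D \<in> P v u" for D
      using that by (auto simp: P_def orient_by_def)
    ultimately show ?thesis
      by blast
  qed
  have fin: "finite (P u v)" "finite (P v u)"
    using finite_acyclic_orientations[OF G] split by auto
  have rec: "orient_by f ?E = insert (a, b) (orient_by f E)"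
    if "f a < f b" "{a, b} = {u, v}" for f a b
    using that by (auto simp: orient_by_def doubleton_eq_iff)
  have inj: "inj_on r (P a b)" if "{a, b} = {u, v}" for a b
  proof (rule inj_onI)
    fix D D' assume D: "D \<in> P a b" "D' \<in> P a b" and eq: "r D = r D'"
    \<comment> \<open>The class fixes the direction of the new edge, so a single known arc has to be
      put back.\<close>
    have "C = insert (a, b) (r C)" if "C \<in> P a b" for C
      using that \<open>{a, b} = {u, v}\<close> by (auto simp: P_def r simp del: insert_iff) (auto simp: rec)
    then show "D = D'"
      using D eq by metis
  qed
  have union: "r ` P u v \<union> r ` P v u = acyclic_orientations E"
  proof (intro equalityI subsetI)
    fix D assume "D \<in> r ` P u v \<union> r ` P v u"
    then show "D \<in> acyclic_orientations E"
      unfolding acyclic_orientations_eq[OF GE] P_def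
      by (auto simp: r dest: proper_insert_subset)
  next
    fix D assume "D \<in> acyclic_orientations E"
    then obtain f where f: "proper f E" "D = orient_by f E"
      by (auto simp: acyclic_orientations_eq[OF GE])
    \<comment> \<open>In whichever direction the weak comparison holds, breaking a possible tie
      extends the orientation to the new edge.\<close>
    consider "f u \<le> f v" | "f v \<le> f u"
      by linarith
    then show "D \<in> r ` P u v \<union> r ` P v u"
    proof cases
      case 1
      then obtain g where g: "proper g ?E" "g u < g v" "orient_by g E = D"
        using break_tie[OF f(1) uv] f(2) by blast
      then have "orient_by g ?E \<in> P u v" "D = r (orient_by g ?E)"
        by (auto simp: P_def r)
      then show ?thesis by blast
    next
      case 2
      then obtain g where g: "proper g ?E" "g v < g u" "orient_by g E = D"
        using break_tie[OF f(1) uv[symmetric]] f(2) by (metis insert_commute)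
      then have "orient_by g ?E \<in> P v u" "D = r (orient_by g ?E)"
        by (auto simp: P_def r)
      then show ?thesis by blast
    qed
  qed
  have inter: "r ` P u v \<inter> r ` P v u = tied_orientations E u v"
  proof (intro equalityI subsetI)
    fix D assume "D \<in> r ` P u v \<inter> r ` P v u"
    then have "D \<in> r ` P u v" "D \<in> r ` P v u"
      by blast+
    then obtain f g where f: "proper f E" "f u < f v" "D = orient_by f E"
      and g: "proper g E" "g v < g u" "D = orient_by g E"
      unfolding P_def using r proper_insert_subset by (smt (verit) image_iff mem_Collect_eq)
    txt \<open>Strict potentials for \<open>D\<close> form a convex cone, so a positive combination of one
      with \<open>f u < f v\<close> and one with \<open>g v < g u\<close> creates the tie.\<close>
    define h where "h y = (g u - g v) * f y + (f v - f u) * g y" for y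
    have "h p < h q" if "{p, q} \<in> E" "f p < f q" for p q
    proof -
      have "(p, q) \<in> D"
        using that f(3) by (simp add: orient_by_def)
      then have "g p < g q"
        using g(3) by (simp add: orient_by_def)
      then show ?thesis
        unfolding h_def using that f(2) g(2) by (intro add_strict_mono mult_strict_left_mono) auto
    qed
    then have "proper h E" "orient_by h E = D"
      using orient_by_cong[OF f(1), of h] f(3) by auto
    \<comment> \<open>Both sides equal \<open>f v * g u - f u * g v\<close>. Over the integers this
      is plain algebra, because the two natural differences in \<open>h\<close> are positive and
      nothing is truncated.\<close>
    moreover have "h u = h v"
    proof -
      have "int (h u) = int (h v)"
        using f(2) g(2) by (simp add: h_def of_nat_diff algebra_simps)
      then show ?thesis by simp
    qed
    ultimately show "D \<in> tied_orientations E u v"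
      by (auto simp: tied_orientations_def)
  next
    fix D assume "D \<in> tied_orientations E u v"
    then obtain f where f: "proper f E" "f u = f v" "D = orient_by f E"
      by (auto simp: tied_orientations_def)
    \<comment> \<open>A tie can be broken in either direction without changing the orientation of
      \<open>E\<close>, which yields a preimage in each class.\<close>
    obtain g where g: "proper g ?E" "g u < g v" "orient_by g E = D"
      using break_tie[OF f(1) uv] f(2,3) by auto
    obtain h where h: "proper h ?E" "h v < h u" "orient_by h E = D"
      using break_tie[OF f(1) uv[symmetric]] f(2,3) by (auto simp: insert_commute)
    have "orient_by g ?E \<in> P u v" "D = r (orient_by g ?E)"
         "orient_by h ?E \<in> P v u" "D = r (orient_by h ?E)"
      using g h by (auto simp: P_def r)
    then show "D \<in> r ` P u v \<inter> r ` P v u"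
      by blast
  qed
  have "card (acyclic_orientations ?E) = card (P u v) + card (P v u)"
    unfolding split by (rule card_Un_disjoint[OF fin disj])
  also have "\<dots> = card (r ` P u v) + card (r ` P v u)"
    by (simp add: card_image inj insert_commute)
  also have "\<dots> = card (acyclic_orientations E) + card (tied_orientations E u v)"
    unfolding union[symmetric] inter[symmetric] by (rule card_Un_Int) (use fin in auto)
  finally show ?thesis .
qed

section \<open>The exchange step\<close>

text \<open>This prepares the move of \<open>c\<close> to the level of \<open>b\<close>: no
  neighbour of \<open>c\<close> may already lie on that level.\<close>

lemma injective_refinement:
  fixes f :: "'a \<Rightarrow> nat"
  assumes "finite V"
  obtains g :: "'a \<Rightarrow> nat" where "inj_on g V"
    "\<And>p q. p \<in> V \<Longrightarrow> q \<in> V \<Longrightarrow> f p < f q \<Longrightarrow> g p < g q"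
proof -
  obtain i :: "'a \<Rightarrow> nat" and N where i: "inj_on i V" "i ` V = {k. k < N}"
    using finite_imp_inj_to_nat_seg[OF assms] by (metis (no_types))
  \<comment> \<open>This encodes the lexicographic order of \<open>(f y, i y)\<close>: on
    \<open>V\<close> the index stays below \<open>N\<close>, so it never outweighs a unit step of
    \<open>f\<close>.\<close>
  define g where "g y = N * f y + i y" for y
  have lt: "i p < N" if "p \<in> V" for p
    using i(2) that by auto
  have mono: "g p < g q" if "p \<in> V" "q \<in> V" "f p < f q" for p q
  proof -
    have "g p < N * (f p + 1)"
      using lt[OF that(1)] by (simp add: g_def)
    also have "\<dots> \<le> N * f q"
      using that(3) by (intro mult_left_mono) auto
    finally show ?thesis
      by (simp add: g_def)
  qed
  moreover have "inj_on g V"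
  proof (rule inj_onI)
    fix p q assume pq: "p \<in> V" "q \<in> V" "g p = g q"
    then have "f p = f q"
      using mono[of p q] mono[of q p] by (metis less_irrefl linorder_neqE_nat)
    then have "i p = i q"
      using pq(3) by (simp add: g_def)
    then show "p = q"
      using i(1) pq by (auto dest: inj_onD)
  qed
  ultimately show thesis
    using that by blast
qed

lemma card_tied_orientations_le:
  assumes G: "simple_graph V E" and x: "x \<in> V" and "b \<in> V" "b \<noteq> c" "x \<noteq> c"
    and xc: "{x, c} \<notin> E" and bc: "{b, c} \<notin> E"
    and univ: "\<And>y. y \<in> V \<Longrightarrow> y \<noteq> x \<Longrightarrow> y \<noteq> c \<Longrightarrow> {x, y} \<in> E"
  shows "card (tied_orientations E x c) \<le> card (tied_orientations E b c)"
proof -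
  have "\<exists>g. inj_on g (V - {c}) \<and> g c = g x \<and> D = orient_by g E"
    if D: "D \<in> tied_orientations E x c" for D
  proof -
    obtain f where f: "proper f E" "f x = f c" "D = orient_by f E"
      using D by (auto simp: tied_orientations_def)
    obtain g :: "'a \<Rightarrow> nat" where g: "inj_on g V"
      "\<And>p q. p \<in> V \<Longrightarrow> q \<in> V \<Longrightarrow> f p < f q \<Longrightarrow> g p < g q"
      using injective_refinement[of V f] G by (auto simp: simple_graph_def)
    \<comment> \<open>The refinement may separate \<open>c\<close> from \<open>x\<close>, so
      \<open>c\<close> is put back on the level of \<open>x\<close>. Its comparisons are then
      inherited from \<open>x\<close>, because \<open>f x = f c\<close>.\<close>
    define h where "h = g(c := g x)"
    have "inj_on h (V - {c})"
      using inj_on_subset[OF g(1), of "V - {c}"] by (auto simp: h_def inj_on_def)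
    moreover have "h p < h q" if e: "{p, q} \<in> E" and "f p < f q" for p q
      using edge_in_graph[OF G e] g(2)[of p q] g(2)[of x q] g(2)[of p x] x that f(2)
      by (auto simp: h_def)
    then have "D = orient_by h E"
      using orient_by_cong[OF f(1), of h] f(3) by auto
    moreover have "h c = h x"
      using \<open>x \<noteq> c\<close> by (simp add: h_def)
    ultimately show ?thesis by blast
  qed
  \<comment> \<open>One potential is fixed per orientation, since the orientation alone need not
    determine how \<open>b\<close> compares with the neighbours of \<open>c\<close>.\<close>
  then obtain g where g: "\<And>D. D \<in> tied_orientations E x c \<Longrightarrow>
      inj_on (g D) (V - {c}) \<and> g D c = g D x \<and> D = orient_by (g D) E"
    by metis
  have mem: "(p, q) \<in> D \<longleftrightarrow> {p, q} \<in> E \<and> g D p < g D q"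
    if "D \<in> tied_orientations E x c" for D p q
  proof -
    have "D = orient_by (g D) E"
      using g[OF that] by blast
    then have "(p, q) \<in> D \<longleftrightarrow> (p, q) \<in> orient_by (g D) E"
      by (rule arg_cong)
    then show ?thesis
      by (simp add: orient_by_def)
  qed
  have nbc: "{p, c} \<in> E \<Longrightarrow> p \<in> V - {c} \<and> p \<noteq> b \<and> p \<noteq> x" for p
    using edge_in_graph[OF G, of p c] bc xc by auto
  define \<phi> where "\<phi> D = orient_by ((g D)(c := g D b)) E" for D
  \<comment> \<open>A neighbour of \<open>c\<close> is neither \<open>b\<close> nor
    \<open>c\<close>, so injectivity away from \<open>c\<close> keeps it off the level of
    \<open>b\<close>.\<close>
  have proper_moved: "proper ((g D)(c := g D b)) E" if D: "D \<in> tied_orientations E x c" for D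
  proof -
    have bV: "b \<in> V - {c}" using \<open>b \<in> V\<close> \<open>b \<noteq> c\<close> by simp
    have inj: "inj_on (g D) (V - {c})" using g[OF D] by blast
    have ne: "g D p \<noteq> g D q" if "p \<in> V - {c}" "q \<in> V - {c}" "p \<noteq> q" for p q
      using inj that by (auto dest: inj_onD)
    show ?thesis
      unfolding proper_def
    proof (intro allI impI)
      fix p q assume e: "{p, q} \<in> E"
      then have e': "{q, p} \<in> E" by (simp add: insert_commute)
      show "((g D)(c := g D b)) p \<noteq> ((g D)(c := g D b)) q"
        using edge_in_graph[OF G e] nbc[of p] nbc[of q] e e' ne[of p q] ne[of p b] ne[of b q] bV
        by auto
    qed
  qed
  have "\<phi> ` tied_orientations E x c \<subseteq> tied_orientations E b c"
  proof clarify
    fix D assume "D \<in> tied_orientations E x c"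
    then have "proper ((g D)(c := g D b)) E"
      by (rule proper_moved)
    moreover have "((g D)(c := g D b)) b = ((g D)(c := g D b)) c"
      by simp
    ultimately show "\<phi> D \<in> tied_orientations E b c"
      unfolding \<phi>_def tied_orientations_def by blast
  qed
  moreover have "inj_on \<phi> (tied_orientations E x c)"
  proof (rule inj_onI)
    fix D D' assume D: "D \<in> tied_orientations E x c" and D': "D' \<in> tied_orientations E x c"
      and eq: "\<phi> D = \<phi> D'"
    \<comment> \<open>Only the value at \<open>c\<close> was changed, so arcs not meeting
      \<open>c\<close> can be read off from the image.\<close>
    have away: "(p, q) \<in> D0 \<longleftrightarrow> (p, q) \<in> \<phi> D0"
      if "D0 \<in> tied_orientations E x c" "p \<noteq> c" "q \<noteq> c" for D0 p q
      using that(2,3) by (simp add: mem[OF that(1)] \<phi>_def orient_by_def)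
    txt \<open>The arcs at \<open>c\<close> copy those at \<open>x\<close>, which are all present.\<close>
    have at_c: "((p, c) \<in> D0 \<longleftrightarrow> {p, c} \<in> E \<and> (p, x) \<in> D0) \<and>
        ((c, p) \<in> D0 \<longleftrightarrow> {p, c} \<in> E \<and> (x, p) \<in> D0)"
      if "D0 \<in> tied_orientations E x c" for D0 p
    proof -
      have "{p, c} \<in> E \<Longrightarrow> {x, p} \<in> E"
        using nbc[of p] univ[of p] by auto
      then show ?thesis
        using g[OF that] by (auto simp: mem[OF that] insert_commute)
    qed
    have away': "(p, q) \<in> D \<longleftrightarrow> (p, q) \<in> D'" if "p \<noteq> c" "q \<noteq> c" for p q
      using away[OF D that] away[OF D' that] eq by simp
    have "(p, q) \<in> D \<longleftrightarrow> (p, q) \<in> D'" for p q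
    proof -
      have cc: "(c, c) \<notin> D" "(c, c) \<notin> D'"
        using at_c[OF D, of c] at_c[OF D', of c] nbc[of c] by auto
      consider "p \<noteq> c" "q \<noteq> c" | "p = c" "q = c" | "p = c" "q \<noteq> c" | "p \<noteq> c" "q = c"
        by blast
      then show ?thesis
      proof cases
        case 1
        then show ?thesis by (rule away')
      next
        case 2
        then show ?thesis using cc by simp
      next
        case 3
        then show ?thesis
          using at_c[OF D, of q] at_c[OF D', of q] away'[of x q] \<open>x \<noteq> c\<close> by simp
      next
        case 4
        then show ?thesis
          using at_c[OF D, of p] at_c[OF D', of p] away'[of p x] \<open>x \<noteq> c\<close> by simp
      qed
    qed
    then show "D = D'" by auto
  qed
  moreover have "finite (tied_orientations E b c)"
    using finite_acyclic_orientations[OF G]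
    by (rule finite_subset[rotated]) (auto simp: acyclic_orientations_eq[OF G] tied_orientations_def)
  ultimately show ?thesis
    using card_inj_on_le by blast
qed

lemma exchange_edge:
  assumes "finite V" and H: "H \<subseteq> all_edges V" and bc: "{b, c} \<in> H"
    and x: "x \<in> V" "x \<notin> \<Union>H"
  shows "card (acyclic_orientations (all_edges V - H)) \<le>
    card (acyclic_orientations (all_edges V - insert {x, c} (H - {{b, c}})))"
proof -
  \<comment> \<open>This is the common subgraph without either edge: the graph before the exchange
    adds \<open>{x, c}\<close> to it, the graph afterwards adds \<open>{b, c}\<close>. The recursion
    then leaves only the tied terms to compare.\<close>
  define E where "E = all_edges V - insert {x, c} H"
  have bcV: "b \<in> V" "c \<in> V" "b \<noteq> c"
    using H bc all_edges_iff[of b c V] by auto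
  have xne: "x \<noteq> b" "x \<noteq> c" "\<And>y. {x, y} \<notin> H"
    using x(2) bc by auto
  have ne: "{x, c} \<noteq> {b, c}"
    using xne by (auto simp: doubleton_eq_iff)
  have xc: "{x, c} \<in> all_edges V" and bcA: "{b, c} \<in> all_edges V"
    using all_edges_iff[of x c V] x bcV xne H bc by auto
  have 1: "all_edges V - H = insert {x, c} E"
    using xc xne(3)[of c] by (auto simp: E_def)
  have 2: "all_edges V - insert {x, c} (H - {{b, c}}) = insert {b, c} E"
    using bcA bc ne by (auto simp: E_def)
  have G: "simple_graph V E" "simple_graph V (insert {x, c} E)" "simple_graph V (insert {b, c} E)"
    using \<open>finite V\<close> xc bcA by (auto simp: simple_graph_def E_def)
  have notin: "{x, c} \<notin> E" "{b, c} \<notin> E"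
    using bc by (auto simp: E_def)
  have "{x, y} \<in> E" if "y \<in> V" "y \<noteq> x" "y \<noteq> c" for y
    using that x xne(3)[of y] all_edges_iff[of x y V] by (auto simp: E_def doubleton_eq_iff)
  then have "card (tied_orientations E x c) \<le> card (tied_orientations E b c)"
    by (intro card_tied_orientations_le[OF G(1) x(1) bcV(1,3) xne(2) notin])
  then show ?thesis
    unfolding 1 2 card_acyclic_orientations_insert[OF G(2) notin(1)]
      card_acyclic_orientations_insert[OF G(3) notin(2)] by simp
qed

section \<open>Reduction to matchings\<close>

lemma all_edges_eq_subsets: "all_edges V = {e. e \<subseteq> V \<and> card e = 2}"
  by (auto simp: all_edges_def card_2_iff)

lemma finite_all_edges: "finite V \<Longrightarrow> finite (all_edges V)"
  by (simp add: all_edges_eq_subsets)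

lemma card_all_edges: "finite V \<Longrightarrow> card (all_edges V) = card V choose 2"
  by (simp add: all_edges_eq_subsets n_subsets)

lemma card_Union_edges_le:
  assumes "finite V" "H \<subseteq> all_edges V"
  shows "card (\<Union>H) \<le> 2 * card H"
proof -
  have fin: "finite H"
    using assms finite_all_edges finite_subset by metis
  have "card (\<Union>H) \<le> (\<Sum>e\<in>H. card e)"
    using card_Union_le_sum_card by blast
  also have "\<dots> = (\<Sum>e\<in>H. 2)"
    by (rule sum.cong) (use assms in \<open>auto simp: all_edges_eq_subsets\<close>)
  finally show ?thesis
    by simp
qed

lemma exists_better_matching:
  assumes "finite V" "H \<subseteq> all_edges V" "2 * card H \<le> card V"
  shows "\<exists>M. M \<subseteq> all_edges V \<and> matching M \<and> card M = card H \<and>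
    card (acyclic_orientations (all_edges V - H)) \<le> card (acyclic_orientations (all_edges V - M))"
  using assms(2,3)
proof (induction "card (V - \<Union>H)" arbitrary: H rule: less_induct)
  case less
  show ?case
  proof (cases "matching H")
    case True
    then show ?thesis
      using less.prems by blast
  next
    case False
    then obtain e e' where e: "e \<in> H" "e' \<in> H" "e \<noteq> e'" "\<not> disjnt e e'"
      by (auto simp: matching_def pairwise_def)
    then obtain b where b: "b \<in> e" "b \<in> e'"
      by (auto simp: disjnt_def)
    obtain c where c: "e = {b, c}" "b \<noteq> c"
      using e(1) b(1) less.prems(1) by (auto simp: all_edges_def)
    have finH: "finite H"
      using less.prems(1) assms(1) finite_all_edges finite_subset by metis
    \<comment> \<open>The vertex \<open>b\<close> also lies on \<open>e'\<close>, so removing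
      \<open>e\<close> can uncover at most \<open>c\<close>.\<close>
    have UH: "\<Union>H = insert c (\<Union>(H - {e}))"
      using e b c by auto
    have sub: "H - {e} \<subseteq> all_edges V"
      using less.prems(1) by blast
    \<comment> \<open>The other edges cover at most \<open>2 * (card H - 1)\<close> vertices and
      \<open>e\<close> adds at most one, so some vertex of \<open>V\<close> is isolated in
      \<open>H\<close>.\<close>
    have "card (\<Union>H) \<le> Suc (card (\<Union>(H - {e})))"
      unfolding UH by (rule card_insert_le_m1) simp_all
    also have "\<dots> \<le> Suc (2 * (card H - 1))"
      using card_Union_edges_le[OF assms(1) sub] e(1) finH by simp
    also have "\<dots> < 2 * card H"
      using e(1) finH card_gt_0_iff[of H] by auto
    finally have lt: "card (\<Union>H) < card V"
      using less.prems(2) by simp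
    have UV: "\<Union>H \<subseteq> V"
      using less.prems(1) by (auto simp: all_edges_eq_subsets)
    then obtain x where x: "x \<in> V" "x \<notin> \<Union>H"
      using lt by (metis less_irrefl subsetI subset_antisym)
    define H' where "H' = insert {x, c} (H - {{b, c}})"
    have cV: "c \<in> \<Union>H"
      using e(1) c by auto
    have "x \<noteq> c"
      using x cV by blast
    then have H': "H' \<subseteq> all_edges V"
      using less.prems(1) x cV UV all_edges_iff[of x c V] by (auto simp: H'_def)
    have "{x, c} \<notin> H"
      using x(2) by auto
    then have cardH': "card H' = card H"
      using e(1) c finH using card_Suc_Diff1[of H e] by (simp add: H'_def)
    \<comment> \<open>The new edge keeps \<open>c\<close> covered and gains \<open>x\<close>, so the
      induction measure, the number of isolated vertices, drops.\<close>
    have "insert x (\<Union>H) \<subseteq> \<Union>H'"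
      using UH c by (auto simp: H'_def)
    then have "V - \<Union>H' \<subset> V - \<Union>H"
      using x by blast
    then have "card (V - \<Union>H') < card (V - \<Union>H)"
      using assms(1) by (intro psubset_card_mono) auto
    then obtain M where M: "M \<subseteq> all_edges V" "matching M" "card M = card H'"
      "card (acyclic_orientations (all_edges V - H')) \<le> card (acyclic_orientations (all_edges V - M))"
      using less.hyps[OF _ H'] less.prems(2) cardH' by auto
    have "card (acyclic_orientations (all_edges V - H)) \<le> card (acyclic_orientations (all_edges V - H'))"
      unfolding H'_def using exchange_edge[OF assms(1) less.prems(1) _ x] e(1) c by simp
    then show ?thesis
      using M cardH' by (intro exI[of _ M]) auto
  qed
qed

section \<open>Isomorphism invariance\<close>

text \<open>One edge is paired with one edge, and a bijection between the remaining vertices is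
  extended by matching up their ends. Once no edge is left, any bijection between the equally many
  leftover vertices will do.\<close>

lemma matchings_isomorphic:
  fixes V :: "'a set" and W :: "'b set"
  assumes "finite M" "finite V" "finite W" "card V = card W"
    and "M \<subseteq> all_edges V" "N \<subseteq> all_edges W" "matching M" "matching N" "card M = card N"
  shows "\<exists>\<sigma>. bij_betw \<sigma> V W \<and> (`) \<sigma> ` M = N"
  using assms
proof (induction M arbitrary: V W N rule: finite_induct)
  case empty
  then have "finite N"
    using finite_all_edges finite_subset by metis
  then have "N = {}"
    using empty by simp
  then show ?case
    using empty finite_same_card_bij[of V W] by auto
next
  case (insert e M)
  have finN: "finite N"
    using insert.prems finite_all_edges finite_subset by metis
  have "card N \<noteq> 0"
    using insert by simp
  then obtain e' where e': "e' \<in> N"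
    by fastforce
  obtain u v where uv: "e = {u, v}" "u \<in> V" "v \<in> V" "u \<noteq> v"
    using insert.prems(4) by (auto simp: all_edges_def)
  obtain u' v' where uv': "e' = {u', v'}" "u' \<in> W" "v' \<in> W" "u' \<noteq> v'"
    using insert.prems(5) e' by (auto simp: all_edges_def)
  define N' where "N' = N - {e'}"
  have N: "N = insert e' N'" "e' \<notin> N'"
    using e' by (auto simp: N'_def)
  \<comment> \<open>Disjointness from the removed edge places the rest of the matching in
    \<open>V - e\<close>, where the induction hypothesis applies.\<close>
  have dM: "e \<inter> d = {}" if "d \<in> M" for d
    using insert.prems(6) insert.hyps(2) that by (auto simp: matching_def pairwise_def disjnt_def)
  have dN: "e' \<inter> d = {}" if "d \<in> N'" for d
    using insert.prems(7) N that by (auto simp: matching_def pairwise_def disjnt_def)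
  have "card (V - e) = card (W - e')"
    using insert.prems(1-3) uv uv' by (simp add: card_Diff_subset)
  moreover have "M \<subseteq> all_edges (V - e)"
  proof
    fix d assume "d \<in> M"
    then show "d \<in> all_edges (V - e)"
      using insert.prems(4) dM[of d] by (auto simp: all_edges_eq_subsets)
  qed
  moreover have "N' \<subseteq> all_edges (W - e')"
  proof
    fix d assume "d \<in> N'"
    then show "d \<in> all_edges (W - e')"
      using insert.prems(5) N(1) dN[of d] by (auto simp: all_edges_eq_subsets)
  qed
  moreover have "matching M" "matching N'"
    using insert.prems(6,7) N by (auto simp: matching_def pairwise_insert)
  moreover have "card M = card N'"
    using insert.prems(8) insert.hyps finN e' by (simp add: N'_def)
  ultimately obtain \<tau> where \<tau>: "bij_betw \<tau> (V - e) (W - e')" "(`) \<tau> ` M = N'"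
    using insert.IH[of "V - e" "W - e'" N'] insert.prems(1,2) by auto
  define \<sigma> where "\<sigma> = \<tau>(u := u', v := v')"
  have \<sigma>_eq: "\<sigma> y = \<tau> y" if "y \<notin> e" for y
    using that uv by (auto simp: \<sigma>_def)
  have "bij_betw \<sigma> (V - e) (W - e')"
    using \<tau>(1) \<sigma>_eq by (subst bij_betw_cong[where g = \<tau>]) auto
  moreover have "bij_betw \<sigma> e e'"
    using uv uv' by (auto simp: bij_betw_def \<sigma>_def)
  ultimately have "bij_betw \<sigma> ((V - e) \<union> e) ((W - e') \<union> e')"
    by (intro bij_betw_combine) auto
  moreover have "(V - e) \<union> e = V" "(W - e') \<union> e' = W"
    using uv uv' by auto
  moreover have "\<sigma> ` d = \<tau> ` d" if "d \<in> M" for d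
    using dM[OF that] \<sigma>_eq by (intro image_cong) auto
  then have "(`) \<sigma> ` M = N'"
    using \<tau>(2) by (metis (no_types, lifting) image_cong)
  moreover have "\<sigma> ` e = e'"
    using \<open>bij_betw \<sigma> e e'\<close> by (simp add: bij_betw_def)
  ultimately show ?case
    using N by (intro exI[of _ \<sigma>]) auto
qed

text \<open>Moving arcs along \<sigma> is injective on orientations, and acyclicity is preserved
  because potentials can be composed with the inverse of \<sigma>.\<close>

lemma card_acyclic_orientations_iso_le:
  assumes F: "simple_graph W F" and \<sigma>: "inj_on \<sigma> W"
    and E: "simple_graph V ((`) \<sigma> ` F)"
  shows "card (acyclic_orientations F) \<le> card (acyclic_orientations ((`) \<sigma> ` F))"
proof (rule card_inj_on_le[OF _ _ finite_acyclic_orientations[OF E]])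
  let ?h = "\<lambda>D. map_prod \<sigma> \<sigma> ` D"
  have sub: "acyclic_orientations F \<subseteq> Pow (W \<times> W)"
    using orientation_subset[OF F] by (auto simp: acyclic_orientations_def)
  have "inj_on (map_prod \<sigma> \<sigma>) (W \<times> W)"
    using \<sigma> by (rule map_prod_inj_on[OF _ \<sigma>])
  then show "inj_on ?h (acyclic_orientations F)"
    using inj_on_subset[OF inj_on_image_Pow sub] by blast
  show "?h ` acyclic_orientations F \<subseteq> acyclic_orientations ((`) \<sigma> ` F)"
  proof clarify
    fix D assume "D \<in> acyclic_orientations F"
    then obtain f where f: "proper f F" "D = orient_by f F"
      by (auto simp: acyclic_orientations_eq[OF F])
    define g where "g = f \<circ> inv_into W \<sigma>"
    have g: "g (\<sigma> y) = f y" if "y \<in> W" for y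
      using that \<sigma> by (simp add: g_def)
    \<comment> \<open>An edge is unordered, so its preimage may have to be listed in reverse to
      match the order of \<open>a\<close> and \<open>b\<close>.\<close>
    have edge: "\<exists>p q. {p, q} \<in> F \<and> p \<in> W \<and> q \<in> W \<and> a = \<sigma> p \<and> b = \<sigma> q"
      if ab: "{a, b} \<in> (`) \<sigma> ` F" for a b
    proof -
      obtain d where d: "d \<in> F" "{a, b} = \<sigma> ` d"
        using ab by auto
      then obtain p q where pq: "d = {p, q}" "p \<in> W" "q \<in> W"
        using F by (auto simp: simple_graph_def all_edges_def)
      then consider "a = \<sigma> p" "b = \<sigma> q" | "a = \<sigma> q" "b = \<sigma> p"
        using d(2) by (auto simp: doubleton_eq_iff)
      then show ?thesis
        using d(1) pq by cases (metis insert_commute)+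
    qed
    have "proper g ((`) \<sigma> ` F)"
      unfolding proper_def
    proof (intro allI impI)
      fix a b assume "{a, b} \<in> (`) \<sigma> ` F"
      then obtain p q where "{p, q} \<in> F" "p \<in> W" "q \<in> W" "a = \<sigma> p" "b = \<sigma> q"
        using edge by blast
      then show "g a \<noteq> g b"
        using g f(1) by (auto simp: proper_def)
    qed
    moreover have "?h D = orient_by g ((`) \<sigma> ` F)"
    proof (intro equalityI subsetI)
      fix z assume "z \<in> ?h D"
      then obtain p q where z: "z = (\<sigma> p, \<sigma> q)" and pq: "{p, q} \<in> F" "f p < f q"
        using f(2) by (auto simp: orient_by_def)
      have "{\<sigma> p, \<sigma> q} \<in> (`) \<sigma> ` F"
        using imageI[OF pq(1), of "(`) \<sigma>"] by simp
      then show "z \<in> orient_by g ((`) \<sigma> ` F)"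
        using z pq edge_in_graph[OF F pq(1)] g by (auto simp: orient_by_def)
    next
      fix z assume "z \<in> orient_by g ((`) \<sigma> ` F)"
      then obtain a b where z: "z = (a, b)" "{a, b} \<in> (`) \<sigma> ` F" "g a < g b"
        by (auto simp: orient_by_def)
      then obtain p q where "{p, q} \<in> F" "p \<in> W" "q \<in> W" "a = \<sigma> p" "b = \<sigma> q"
        using edge by blast
      then have "(p, q) \<in> D" "z = map_prod \<sigma> \<sigma> (p, q)"
        using z g f(2) by (auto simp: orient_by_def)
      then show "z \<in> ?h D"
        by blast
    qed
    ultimately show "?h D \<in> acyclic_orientations ((`) \<sigma> ` F)"
      by (auto simp: acyclic_orientations_eq[OF E])
  qed
qed

lemma image_all_edges:
  assumes "bij_betw \<sigma> W V"
  shows "(`) \<sigma> ` all_edges W = all_edges V"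
proof (intro equalityI subsetI)
  fix e assume "e \<in> (`) \<sigma> ` all_edges W"
  then obtain u v where "e = {\<sigma> u, \<sigma> v}" "u \<in> W" "v \<in> W" "u \<noteq> v"
    by (auto simp: all_edges_def)
  then show "e \<in> all_edges V"
    using assms by (auto simp: all_edges_iff bij_betw_def inj_on_def)
next
  fix e assume "e \<in> all_edges V"
  then obtain a b where ab: "e = {a, b}" "a \<in> V" "b \<in> V" "a \<noteq> b"
    by (auto simp: all_edges_def)
  then obtain u v where uv: "a = \<sigma> u" "b = \<sigma> v" "u \<in> W" "v \<in> W"
    using assms by (auto simp: bij_betw_def)
  then have "{u, v} \<in> all_edges W" "e = \<sigma> ` {u, v}"
    using ab by (auto simp: all_edges_iff)
  then show "e \<in> (`) \<sigma> ` all_edges W"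
    by blast
qed

section \<open>Comparison with a given matching, and edge counts of complements\<close>

lemma card_acyclic_orientations_le_matching:
  fixes V :: "'a set" and W :: "'b set"
  assumes fin: "finite V" "finite W" "card V = card W"
    and M: "M \<subseteq> all_edges V" "matching M" and H: "H \<subseteq> all_edges W" "card H = card M"
    and small: "2 * card M \<le> card V"
  shows "card (acyclic_orientations (all_edges W - H)) \<le> card (acyclic_orientations (all_edges V - M))"
proof -
  \<comment> \<open>The set \<open>H\<close> is first improved to a matching inside
    \<open>W\<close>; having as many edges as \<open>M\<close>, it can then be carried onto
    \<open>M\<close>.\<close>
  obtain N where N: "N \<subseteq> all_edges W" "matching N" "card N = card H"
    "card (acyclic_orientations (all_edges W - H)) \<le> card (acyclic_orientations (all_edges W - N))"
    using exists_better_matching[OF fin(2) H(1)] H(2) small fin(3) by auto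
  have "finite N"
    using N(1) fin finite_all_edges finite_subset by metis
  then obtain \<sigma> where \<sigma>: "bij_betw \<sigma> W V" "(`) \<sigma> ` N = M"
    using matchings_isomorphic[of N W V M] fin N M H(2) by auto
  have inj: "inj_on \<sigma> W"
    using \<sigma>(1) by (simp add: bij_betw_def)
  \<comment> \<open>Since \<sigma> acts injectively on subsets of \<open>W\<close>, taking images
    commutes with complementation in the full edge set.\<close>
  have "all_edges W \<subseteq> Pow W"
    by (auto simp: all_edges_eq_subsets)
  then have "inj_on ((`) \<sigma>) (all_edges W)"
    using inj_on_subset[OF inj_on_image_Pow[OF inj]] by blast
  then have img: "(`) \<sigma> ` (all_edges W - N) = all_edges V - M"
    using inj_on_image_set_diff[of "(`) \<sigma>" "all_edges W" "all_edges W" N] N(1)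
      image_all_edges[OF \<sigma>(1)] \<sigma>(2) by auto
  have "card (acyclic_orientations (all_edges W - N)) \<le> card (acyclic_orientations (all_edges V - M))"
    using card_acyclic_orientations_iso_le[of W "all_edges W - N" \<sigma> V] inj fin
    by (simp add: img simple_graph_def)
  with N(4) show ?thesis
    by simp
qed

text \<open>This makes every admissible \<open>m\<close> nonnegative, so that a set of
  \<open>(n choose 2) - m\<close> edges exists. For \<open>n\<close> at least two it follows from
  \<open>n \<le> n * (n - 1)\<close>.\<close>

lemma half_le_choose_two: "n div 2 \<le> n choose 2"
proof (cases "n \<le> 1")
  case True
  then show ?thesis by simp
next
  case False
  then have "n * 1 \<le> n * (n - 1)"
    by (intro mult_left_mono) auto
  then show ?thesis
    by (simp add: choose_two div_le_mono)
qed

lemma complement_edges_in_graph: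
  assumes "simple_graph V E"
  shows "int (card (complement_edges V E)) = int (card V choose 2) - int (card E)"
    "complement_edges V E \<subseteq> all_edges V" "all_edges V - complement_edges V E = E"
proof -
  have E: "E \<subseteq> all_edges V" "finite V"
    using assms by (auto simp: simple_graph_def)
  then have "card E \<le> card V choose 2" "finite E"
    using card_mono[OF finite_all_edges[OF E(2)] E(1)] card_all_edges[of V]
      finite_all_edges[of V] finite_subset by auto
  then show "int (card (complement_edges V E)) = int (card V choose 2) - int (card E)"
    using E by (simp add: complement_edges_def card_Diff_subset card_all_edges of_nat_diff)
qed (use assms in \<open>auto simp: complement_edges_def simple_graph_def\<close>)

theorem theorem7p4:
  fixes n :: nat and m :: int and V :: "'a set"
  assumes "n \<ge> 1"
    and "int (n choose 2) - \<lfloor>real n / 2\<rfloor> \<le> m"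
    and "m \<le> int (n choose 2)"
    and "finite V" and "card V = n"
  shows "(\<exists>E. simple_graph V E \<and> int (card E) = m \<and> matching (complement_edges V E)) \<and>
    (\<forall>E. simple_graph V E \<and> int (card E) = m \<and> matching (complement_edges V E) \<longrightarrow>
       int (card (complement_edges V E)) = int (n choose 2) - m \<and>
       (\<forall>(W :: 'b set) F. simple_graph W F \<and> card W = n \<and> int (card F) = m \<longrightarrow>
          card (acyclic_orientations F) \<le> card (acyclic_orientations E)))"
proof -
  have floor: "\<lfloor>real n / 2\<rfloor> = int (n div 2)"
    using floor_divide_of_nat_eq[of n 2, where ?'a = real] by simp
  \<comment> \<open>The number of missing edges; the lower bound on \<open>m\<close> says that it is
    at most \<open>n div 2\<close>, which is the size condition of the exchange argument.\<close>
  define r where "r = nat (int (n choose 2) - m)"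
  have r: "int r = int (n choose 2) - m" "2 * r \<le> n" "r \<le> n choose 2"
    using assms(2,3) half_le_choose_two[of n] unfolding floor r_def by linarith+
  show ?thesis
  proof (intro conjI allI impI)
    \<comment> \<open>An arbitrary set of \<open>r\<close> edges suffices as a start, since the
      exchange argument turns it into a matching of the same size.\<close>
    obtain H where H: "H \<subseteq> all_edges V" "card H = r"
      using r(3) card_all_edges[OF assms(4)] assms(5) by (metis obtain_subset_with_card_n)
    then obtain M where M: "M \<subseteq> all_edges V" "matching M" "card M = r"
      using exists_better_matching[OF assms(4) H(1)] r(2) assms(5) by auto
    have "card (all_edges V - M) = (n choose 2) - r"
      using M card_all_edges[OF assms(4)] finite_all_edges[OF assms(4)] assms(5)
      by (simp add: card_Diff_subset finite_subset)
    then have "int (card (all_edges V - M)) = m"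
      using r by simp
    moreover have "complement_edges V (all_edges V - M) = M"
      using M(1) by (auto simp: complement_edges_def)
    ultimately show "\<exists>E. simple_graph V E \<and> int (card E) = m \<and> matching (complement_edges V E)"
      using M(2) assms(4) by (intro exI[of _ "all_edges V - M"]) (auto simp: simple_graph_def)
  next
    fix E assume "simple_graph V E \<and> int (card E) = m \<and> matching (complement_edges V E)"
    then show "int (card (complement_edges V E)) = int (n choose 2) - m"
      using complement_edges_in_graph(1)[of V E] assms(5) by simp
  next
    fix E and W :: "'b set" and F
    assume E: "simple_graph V E \<and> int (card E) = m \<and> matching (complement_edges V E)"
      and F: "simple_graph W F \<and> card W = n \<and> int (card F) = m"
    have GE: "simple_graph V E" and GF: "simple_graph W F"
      using E F by auto
    have "card (complement_edges V E) = r" "card (complement_edges W F) = r"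
      using complement_edges_in_graph(1)[OF GE] complement_edges_in_graph(1)[OF GF] E F r(1) assms(5)
      by auto
    then have "card (acyclic_orientations (all_edges W - complement_edges W F))
        \<le> card (acyclic_orientations (all_edges V - complement_edges V E))"
      using E F assms(4,5) r(2) complement_edges_in_graph(2)[OF GE] complement_edges_in_graph(2)[OF GF]
      by (intro card_acyclic_orientations_le_matching) (auto simp: simple_graph_def)
    then show "card (acyclic_orientations F) \<le> card (acyclic_orientations E)"
      by (simp add: complement_edges_in_graph(3)[OF GE] complement_edges_in_graph(3)[OF GF])
  qed
qed

end
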